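(* Let $(X,d)$ be a complete metric space and let $(f_n)_{n\ge1}$ be an eventually decreasing Cauchy sequence in $(Con(X),\bar{d}_\infty)$. Then $(f_n)_{n\ge1}$ converges in $Con(X)$, i.e. there exists $f\in Con(X)$ with $\bar{d}_\infty(f_n,f)\to 0$ as $n\to\infty$.
   Context: A contraction on $X$ is a map $f:X\to X$ having a contractivity factor $c_f\in[0,1)$, i.e. a constant with $d(f(x),f(y))\le c_f\,d(x,y)$ for all $x,y\in X$; each contraction $f$ is considered together with its contractivity factor $c_f$. $Con(X)$ denotes the set of all contractions on $X$, with the metric $$\bar{d}_\infty(f,g)=\sup_{x\in X}\frac{d(f(x),g(x))}{1+d(f(x),g(x))}.$$ A sequence $(f_n)_{n\ge1}$ in $Con(X)$, with $c_n$ the contractivity factor of $f_n$, is eventually decreasing if there exists $N\in\mathbb{N}$ such that $c_{n+1}\le c_n$ for every $n\ge N$. *)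

theory Defs
  imports "HOL-Analysis.Analysis"
begin

definition contractivity_factor :: "real \<Rightarrow> ('a::metric_space \<Rightarrow> 'a) \<Rightarrow> bool" where
  "contractivity_factor c f \<longleftrightarrow> c < 1 \<and> c-lipschitz_on UNIV f"

lemma contractivity_factor_iff:
  "contractivity_factor c f \<longleftrightarrow>
     c \<in> {0..<1} \<and> (\<forall>x y. dist (f x) (f y) \<le> c * dist x y)"
  by (auto simp: contractivity_factor_def lipschitz_on_def)

definition Con :: "('a::metric_space \<Rightarrow> 'a) set" where
  "Con = {f. \<exists>c. contractivity_factor c f}"

definition Con_dist :: "('a::metric_space \<Rightarrow> 'a) \<Rightarrow> ('a \<Rightarrow> 'a) \<Rightarrow> real" where
  "Con_dist f g = (SUP x. dist (f x) (g x) / (1 + dist (f x) (g x)))"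

text \<open>
  A contraction does not determine its contractivity factor, so the sequence \<open>c\<close> of factors is
  carried along with the sequence \<open>f\<close> of contractions.
\<close>

definition eventually_decreasing ::
  "(nat \<Rightarrow> 'a::metric_space \<Rightarrow> 'a) \<Rightarrow> (nat \<Rightarrow> real) \<Rightarrow> bool" where
  "eventually_decreasing f c \<longleftrightarrow>
     (\<forall>n. contractivity_factor (c n) (f n)) \<and> (\<exists>N. \<forall>n\<ge>N. c (Suc n) \<le> c n)"

lemma bdd_above_Con_dist:
  fixes f g :: "'a::metric_space \<Rightarrow> 'a"
  shows "bdd_above (range (\<lambda>x. dist (f x) (g x) / (1 + dist (f x) (g x))))"
proof (rule bdd_aboveI2)
  fix x
  have "0 < 1 + dist (f x) (g x)"
    by (simp add: add_pos_nonneg)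
  then show "dist (f x) (g x) / (1 + dist (f x) (g x)) \<le> 1"
    by (simp add: divide_simps)
qed

lemma Con_dist_upper:
  fixes f g :: "'a::metric_space \<Rightarrow> 'a"
  shows "dist (f x) (g x) / (1 + dist (f x) (g x)) \<le> Con_dist f g"
  unfolding Con_dist_def by (rule cSUP_upper[OF UNIV_I bdd_above_Con_dist])

lemma bounded_dist_triangle:
  fixes a b t :: real
  assumes "0 \<le> a" "0 \<le> b" "0 \<le> t" "t \<le> a + b"
  shows "t / (1 + t) \<le> a / (1 + a) + b / (1 + b)"
proof -
  have "t / (1 + t) \<le> (a + b) / (1 + (a + b))"
    using assms by (simp add: field_simps)
  also have "\<dots> = a / (1 + (a + b)) + b / (1 + (a + b))"
    by (simp add: add_divide_distrib)
  also have "\<dots> \<le> a / (1 + a) + b / (1 + b)"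
    using assms by (intro add_mono divide_left_mono) auto
  finally show ?thesis .
qed

lemma Metric_space_Con: "Metric_space (Con :: ('a::metric_space \<Rightarrow> 'a) set) Con_dist"
proof
  fix f g h :: "'a \<Rightarrow> 'a"
  show nonneg: "0 \<le> Con_dist f g"
    by (rule order_trans[OF _ Con_dist_upper[of f undefined g]]) simp
  show "Con_dist f g = Con_dist g f"
    by (simp add: Con_dist_def dist_commute)
  show "Con_dist f g = 0 \<longleftrightarrow> f = g"
  proof
    assume z: "Con_dist f g = 0"
    show "f = g"
    proof
      fix x
      have p: "0 < 1 + dist (f x) (g x)"
        by (simp add: add_pos_nonneg)
      have "dist (f x) (g x) / (1 + dist (f x) (g x)) \<le> 0"
        using Con_dist_upper[of f x g] z by simp
      with p have "dist (f x) (g x) \<le> 0"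
        by (simp add: divide_le_0_iff)
      then show "f x = g x" by simp
    qed
  qed (simp add: Con_dist_def)
  show "Con_dist f h \<le> Con_dist f g + Con_dist g h"
    unfolding Con_dist_def[of f h]
  proof (rule cSUP_least)
    fix x
    have "dist (f x) (h x) / (1 + dist (f x) (h x))
        \<le> dist (f x) (g x) / (1 + dist (f x) (g x)) + dist (g x) (h x) / (1 + dist (g x) (h x))"
      by (rule bounded_dist_triangle) (auto intro: dist_triangle)
    also have "\<dots> \<le> Con_dist f g + Con_dist g h"
      by (intro add_mono Con_dist_upper)
    finally show "dist (f x) (h x) / (1 + dist (f x) (h x)) \<le> Con_dist f g + Con_dist g h" .
  qed simp
qed

end

theory Submission
  imports Defs
begin

text \<open>
  The sequence converges uniformly for the bounded metric \<open>d / (1 + d)\<close>, since its pointwise limit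
  \<open>g\<close> exists by completeness of the space (\<open>MCauchy_Con_imp_Cauchy\<close>) and the bounds between terms
  of the sequence pass to the limit (\<open>Con_dist_limit_le\<close>).  The limit of contractions need only be
  nonexpansive in general; the role of the eventually decreasing factors is that from some index
  \<open>N\<close> on the single factor \<open>c N < 1\<close> serves for every term, and Lipschitz bounds with a common
  constant survive pointwise limits (\<open>lipschitz_on_pointwise_limit\<close>), so \<open>g\<close> is again a contraction.
\<close>

lemma Con_dist_less_imp_dist_less:
  assumes "0 < e" and "Con_dist f g < e / (1 + e)"
  shows "dist (f x) (g x) < e"
proof -
  have "0 < 1 + dist (f x) (g x)"
    by (simp add: add_pos_nonneg)
  moreover have "dist (f x) (g x) / (1 + dist (f x) (g x)) < e / (1 + e)"
    using Con_dist_upper[of f x g] assms(2) by simp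
  ultimately show ?thesis
    using assms(1) by (simp add: field_simps)
qed

lemma MCauchy_Con_imp_Cauchy:
  fixes f :: "nat \<Rightarrow> 'a::metric_space \<Rightarrow> 'a"
  assumes "Metric_space.MCauchy Con Con_dist f"
  shows "Cauchy (\<lambda>n. f n x)"
proof (rule metric_CauchyI)
  fix e :: real
  assume e: "0 < e"
  then have "0 < e / (1 + e)" by simp
  then obtain N where "\<And>m n. N \<le> m \<Longrightarrow> N \<le> n \<Longrightarrow> Con_dist (f m) (f n) < e / (1 + e)"
    using assms unfolding Metric_space.MCauchy_def[OF Metric_space_Con] by blast
  then show "\<exists>M. \<forall>m\<ge>M. \<forall>n\<ge>M. dist (f m x) (f n x) < e"
    using Con_dist_less_imp_dist_less[OF e] by blast
qed

lemma Con_dist_limit_le: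
  assumes lim: "\<And>x. (\<lambda>n. f n x) \<longlonglongrightarrow> g x"
    and le: "\<forall>\<^sub>F n in sequentially. Con_dist h (f n) \<le> e"
  shows "Con_dist h g \<le> e"
  unfolding Con_dist_def
proof (rule cSUP_least)
  fix x
  have "1 + dist (h x) (g x) \<noteq> 0"
    using zero_le_dist[of "h x" "g x"] by linarith
  then have "(\<lambda>n. dist (h x) (f n x) / (1 + dist (h x) (f n x)))
      \<longlonglongrightarrow> dist (h x) (g x) / (1 + dist (h x) (g x))"
    by (intro tendsto_intros lim)
  moreover have "\<forall>\<^sub>F n in sequentially. dist (h x) (f n x) / (1 + dist (h x) (f n x)) \<le> e"
    using le by eventually_elim (rule order_trans[OF Con_dist_upper])
  ultimately show "dist (h x) (g x) / (1 + dist (h x) (g x)) \<le> e"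
    by (rule tendsto_upperbound) simp
qed simp

lemma lipschitz_on_pointwise_limit:
  fixes f :: "nat \<Rightarrow> 'a::metric_space \<Rightarrow> 'b::metric_space"
  assumes lim: "\<And>x. x \<in> S \<Longrightarrow> (\<lambda>n. f n x) \<longlonglongrightarrow> g x"
    and lip: "\<forall>\<^sub>F n in sequentially. L-lipschitz_on S (f n)"
  shows "L-lipschitz_on S g"
proof (rule lipschitz_onI)
  fix x y
  assume xy: "x \<in> S" "y \<in> S"
  have "(\<lambda>n. dist (f n x) (f n y)) \<longlonglongrightarrow> dist (g x) (g y)"
    by (intro tendsto_dist lim xy)
  moreover have "\<forall>\<^sub>F n in sequentially. dist (f n x) (f n y) \<le> L * dist x y"
    using lip by eventually_elim (rule lipschitz_onD[OF _ xy])
  ultimately show "dist (g x) (g y) \<le> L * dist x y"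
    by (rule tendsto_upperbound) simp
next
  show "0 \<le> L"
    using eventually_happens'[OF sequentially_bot lip] lipschitz_on_nonneg by blast
qed

theorem theorem3p5:
  fixes f :: "nat \<Rightarrow> 'a::complete_space \<Rightarrow> 'a" and c :: "nat \<Rightarrow> real"
  assumes "eventually_decreasing f c"
    and "Metric_space.MCauchy Con Con_dist f"
  shows "\<exists>g\<in>Con. (\<lambda>n. Con_dist (f n) g) \<longlonglongrightarrow> 0"
proof -
  from assms(1) obtain N
    where fac: "\<And>n. contractivity_factor (c n) (f n)"
      and dec: "\<And>n. N \<le> n \<Longrightarrow> c (Suc n) \<le> c n"
    unfolding eventually_decreasing_def by blast
  have "\<exists>l. (\<lambda>n. f n x) \<longlonglongrightarrow> l" for x
    using MCauchy_Con_imp_Cauchy[OF assms(2)] by (simp add: Cauchy_convergent_iff convergent_def)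
  then obtain g where lim: "\<And>x. (\<lambda>n. f n x) \<longlonglongrightarrow> g x"
    by metis
  have "(c N)-lipschitz_on UNIV (f n)" if "N \<le> n" for n
  proof -
    have "c n \<le> c N"
      using that by (induction rule: dec_induct) (use dec order_trans in blast)+
    then show ?thesis
      using fac[of n] lipschitz_on_le unfolding contractivity_factor_def by blast
  qed
  then have "(c N)-lipschitz_on UNIV g"
    by (intro lipschitz_on_pointwise_limit[of UNIV f] lim)
       (auto simp: eventually_sequentially)
  then have "g \<in> Con"
    using fac[of N] unfolding Con_def contractivity_factor_def by blast
  moreover have "(\<lambda>n. Con_dist (f n) g) \<longlonglongrightarrow> 0"
  proof (rule LIMSEQ_I)
    fix r :: real
    assume "0 < r"
    then have "0 < r / 2" by simp
    then obtain M where M: "\<And>m n. M \<le> m \<Longrightarrow> M \<le> n \<Longrightarrow> Con_dist (f m) (f n) < r / 2"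
      using assms(2) unfolding Metric_space.MCauchy_def[OF Metric_space_Con] by blast
    have "norm (Con_dist (f n) g - 0) < r" if "M \<le> n" for n
    proof -
      have "\<forall>\<^sub>F m in sequentially. Con_dist (f n) (f m) \<le> r / 2"
        using M[OF that] by (auto simp: eventually_sequentially intro: less_imp_le)
      then have "Con_dist (f n) g \<le> r / 2"
        by (rule Con_dist_limit_le[OF lim])
      then show ?thesis
        using \<open>0 < r\<close> Metric_space.nonneg[OF Metric_space_Con, of "f n" g] by simp
    qed
    then show "\<exists>no. \<forall>n\<ge>no. norm (Con_dist (f n) g - 0) < r" by blast
  qed
  ultimately show ?thesis by blast
qed

end
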